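(* Let $\sigma(z):=-\frac{z}{1-z}$ and $u:=\frac{z}{2-z}$, both regarded as elements of $\mathbb C[[z]]$. A formal power series $U(z)\in\mathbb C[[z]]$ satisfies $U(\sigma(z))=-U(z)$ if and only if there is a unique $\Phi(t)\in\mathbb C[[t]]$ such that $$U(z)=u\,\Phi(u^2).$$ More generally, for arbitrary $q\in\mathbb C$, the two eigenspaces (for the eigenvalues $+1$ and $-1$ respectively) of the operator on $\mathbb C[[z]]$ given by $$(\mathscr T_qh)(z)=(1-z)^q\,h(\sigma(z))$$ are $$E_q^+=(1-z)^{q/2}\,\mathbb C[[u^2]],\qquad E_q^-=(1-z)^{q/2}\,u\,\mathbb C[[u^2]].$$
   Context: For $\beta\in\mathbb C$, $(1-z)^\beta:=\sum_{k\ge0}\binom{\beta}{k}(-z)^k\in\mathbb C[[z]]$. $\mathbb C[[u^2]]$ denotes the set of series $\Phi(u^2)$, $\Phi\in\mathbb C[[t]]$, viewed in $\mathbb C[[z]]$ by substituting $u=z/(2-z)$. *)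

theory Defs
  imports Complex_Main "HOL-Computational_Algebra.Formal_Power_Series"
begin

unbundle fps_syntax

definition sigma_ser :: "complex fps" where
  "sigma_ser = - (fps_X / (1 - fps_X))"

definition u_ser :: "complex fps" where
  "u_ser = fps_X / (2 - fps_X)"

text \<open>
  Composition \<^const>\<open>fps_compose\<close> agrees with substitution of formal power series only when the
  inner series has zero constant term, as it does in all uses below.
\<close>

lemma sigma_ser_nth_0: "sigma_ser $ 0 = 0"
  by (simp add: sigma_ser_def fps_divide_unit)

lemma u_ser_nth_0: "u_ser $ 0 = 0"
  by (simp add: u_ser_def fps_divide_unit)

definition one_minus_pow :: "complex \<Rightarrow> complex fps" where
  "one_minus_pow \<beta> = fps_binomial \<beta> oo (- fps_X)"

lemma one_minus_pow_nth: "one_minus_pow \<beta> $ k = (\<beta> gchoose k) * (- 1) ^ k"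
proof -
  have pow: "(- fps_X :: complex fps) ^ i = fps_const ((- 1) ^ i) * fps_X ^ i" for i
    by (simp add: power_minus[of fps_X] fps_const_power[symmetric] del: fps_const_power
        flip: fps_const_neg)
  have "(- fps_X :: complex fps) ^ i $ k = (if k = i then (- 1) ^ i else 0)" for i
    by (simp add: pow)
  then have "one_minus_pow \<beta> $ k
      = (\<Sum>i = 0..k. if k = i then (\<beta> gchoose i) * (- 1) ^ i else 0)"
    unfolding one_minus_pow_def fps_compose_nth by (intro sum.cong) auto
  then show ?thesis
    by simp
qed

definition fps_in_u_sq :: "complex fps set" where
  "fps_in_u_sq = {\<Phi> oo u_ser\<^sup>2 | \<Phi>. True}"

definition T_op :: "complex \<Rightarrow> complex fps \<Rightarrow> complex fps" where
  "T_op q h = one_minus_pow q * (h oo sigma_ser)"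

text \<open>
  The complex scalar multiple of a power series \<open>h\<close> by \<open>c\<close> is \<open>fps_const c * h\<close>.
\<close>

definition eigenspace :: "(complex fps \<Rightarrow> complex fps) \<Rightarrow> complex \<Rightarrow> complex fps set" where
  "eigenspace T c = {h. T h = fps_const c * h}"

definition eigenvalue :: "(complex fps \<Rightarrow> complex fps) \<Rightarrow> complex \<Rightarrow> bool" where
  "eigenvalue T c \<longleftrightarrow> (\<exists>h. h \<noteq> 0 \<and> T h = fps_const c * h)"

end

(*
  The substitution sigma maps u to -u, and u is a local coordinate (its linear coefficient is
  1/2). Writing h = H oo u, the invariance and anti-invariance of h under sigma become evenness
  and oddness of H. The weighted operator reduces to the case q = 0: since 1 - sigma = 1/(1 - z),
  conjugation by (1 - z)^(q/2) turns T_q into plain substitution of sigma.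
*)
theory Submission
  imports Defs
begin

section \<open>Even and odd power series\<close>

lemma fps_compose_X_square_nth:
  "(\<Phi> oo fps_X\<^sup>2) $ n = (if even n then \<Phi> $ (n div 2) else (0 :: 'a :: comm_ring_1))"
proof -
  have "(\<Phi> oo fps_X\<^sup>2) $ n = (\<Sum>i=0..n. if n = 2 * i then \<Phi> $ i else 0)"
    by (auto simp: fps_compose_nth fps_X_power_nth simp flip: power_mult intro!: sum.cong)
  also have "\<dots> = (\<Sum>i\<in>{i \<in> {0..n}. n = 2 * i}. \<Phi> $ i)"
    by (simp add: sum.If_cases Int_def)
  also have "{i \<in> {0..n}. n = 2 * i} = (if even n then {n div 2} else {})"
    by auto
  finally show ?thesis
    by simp
qed

text \<open>Substituting -z negates exactly the coefficients of odd index, and in characteristic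
  zero \<open>- a = a\<close> forces \<open>a = 0\<close>. The surviving even coefficients form the
  witness.\<close>

lemma fps_even_iff:
  fixes H :: "'a :: {idom, ring_char_0} fps"
  shows "H oo (- fps_X) = H \<longleftrightarrow> (\<exists>\<Phi>. H = \<Phi> oo fps_X\<^sup>2)"
proof
  assume H: "H oo (- fps_X) = H"
  have "H $ n = 0" if "odd n" for n
  proof -
    have "- H $ n = H $ n"
      using arg_cong[OF H, of "\<lambda>f. f $ n"] that by (simp add: fps_compose_uminus')
    then show ?thesis
      by (simp add: neg_equal_zero)
  qed
  then have "H = Abs_fps (\<lambda>n. H $ (2 * n)) oo fps_X\<^sup>2"
    by (auto simp: fps_eq_iff fps_compose_X_square_nth)
  then show "\<exists>\<Phi>. H = \<Phi> oo fps_X\<^sup>2" ..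
next
  assume "\<exists>\<Phi>. H = \<Phi> oo fps_X\<^sup>2"
  then show "H oo (- fps_X) = H"
    by (auto simp: fps_eq_iff fps_compose_uminus' fps_compose_X_square_nth)
qed

text \<open>The factor \<open>fps_X\<close> absorbs the sign, so oddness of a multiple of z is
  evenness of its quotient by z.\<close>

lemma fps_odd_iff:
  fixes H :: "'a :: {idom, ring_char_0} fps"
  shows "H oo (- fps_X) = - H \<longleftrightarrow> (\<exists>\<Phi>. H = fps_X * (\<Phi> oo fps_X\<^sup>2))"
proof -
  have X: "(fps_X * K) oo (- fps_X) = - (fps_X * (K oo (- fps_X)))" for K :: "'a fps"
    by (simp add: fps_compose_mult_distrib)
  show ?thesis
  proof
    assume H: "H oo (- fps_X) = - H"
    have "H $ 0 = - H $ 0"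
      using arg_cong[OF H, of "\<lambda>f. f $ 0"] by simp
    then have "H $ 0 = 0"
      by (simp add: equal_neg_zero)
    \<comment> \<open>Division by z is exact because the constant term vanishes.\<close>
    then have HK: "H = fps_X * fps_shift 1 H"
      by (auto simp: fps_eq_iff)
    with H X[of "fps_shift 1 H"] have "fps_X * (fps_shift 1 H oo (- fps_X)) = fps_X * fps_shift 1 H"
      by simp
    then have "fps_shift 1 H oo (- fps_X) = fps_shift 1 H"
      by simp
    with HK show "\<exists>\<Phi>. H = fps_X * (\<Phi> oo fps_X\<^sup>2)"
      unfolding fps_even_iff by metis
  next
    assume "\<exists>\<Phi>. H = fps_X * (\<Phi> oo fps_X\<^sup>2)"
    then show "H oo (- fps_X) = - H"
      using X fps_even_iff by metis
  qed
qed

text \<open>Substituting -z acts diagonally on coefficients, with entries \<open>(- 1) ^ n\<close>;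
  any single nonzero coefficient therefore determines \<open>c\<close>.\<close>

lemma fps_compose_uminus_X_eigenvalue:
  fixes H :: "'a :: idom fps"
  assumes "H oo (- fps_X) = fps_const c * H" and "H \<noteq> 0"
  shows "c = 1 \<or> c = - 1"
proof -
  from \<open>H \<noteq> 0\<close> obtain n where n: "H $ n \<noteq> 0"
    by (auto simp: fps_eq_iff)
  have "(- 1) ^ n * H $ n = c * H $ n"
    using arg_cong[OF assms(1), of "\<lambda>f. f $ n"] by (simp add: fps_compose_uminus')
  then have "c = (- 1) ^ n"
    using n by simp
  then show ?thesis
    by (cases "even n") auto
qed

section \<open>The coordinate u\<close>

lemma u_ser_mult: "u_ser * (2 - fps_X) = fps_X"
proof -
  have "(2 - fps_X :: complex fps) $ 0 \<noteq> 0"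
    by simp
  then show ?thesis
    unfolding u_ser_def by (simp add: fps_divide_unit mult.assoc inverse_mult_eq_1)
qed

text \<open>As u has no constant term, comparing linear coefficients in u(2 - z) = z settles this.
  It makes u invertible under composition.\<close>

lemma u_ser_nth_1: "u_ser $ 1 \<noteq> 0"
proof
  assume "u_ser $ 1 = 0"
  then have "(u_ser * (2 - fps_X)) $ 1 = 0"
    by (simp add: fps_mult_nth_1 u_ser_nth_0)
  then show False
    by (simp add: u_ser_mult)
qed

lemma u_ser_nonzero: "u_ser \<noteq> 0"
  using u_ser_nth_1 by auto

lemma sigma_ser_mult: "sigma_ser * (1 - fps_X) = - fps_X"
  by (simp add: sigma_ser_def fps_divide_unit mult.assoc inverse_mult_eq_1)

text \<open>Substitute sigma into u(2 - z) = z and clear the denominator 1 - z, using (2 - sigma)(1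
  - z) = 2(1 - z) + z = 2 - z.\<close>

lemma u_ser_compose_sigma: "u_ser oo sigma_ser = - u_ser"
proof -
  have "(u_ser oo sigma_ser) * (2 - sigma_ser) = sigma_ser"
    using arg_cong[OF u_ser_mult, of "\<lambda>f. f oo sigma_ser"]
    by (simp add: fps_compose_mult_distrib fps_compose_sub_distrib sigma_ser_nth_0)
  then have "(u_ser oo sigma_ser) * ((2 - sigma_ser) * (1 - fps_X)) = sigma_ser * (1 - fps_X)"
    by (simp add: mult.assoc[symmetric])
  also have "(2 - sigma_ser) * (1 - fps_X) = 2 - fps_X"
    using sigma_ser_mult by (simp add: algebra_simps)
  also have "sigma_ser * (1 - fps_X) = (- u_ser) * (2 - fps_X)"
    by (simp only: sigma_ser_mult minus_mult_left[symmetric] u_ser_mult)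
  finally have "(u_ser oo sigma_ser) * (2 - fps_X) = (- u_ser) * (2 - fps_X)" .
  moreover have "(2 - fps_X :: complex fps) $ 0 \<noteq> 0"
    by simp
  then have "2 - fps_X \<noteq> (0 :: complex fps)"
    by (metis fps_zero_nth)
  ultimately show ?thesis
    by (metis mult_right_cancel)
qed

lemma ex_compose_u_ser: "\<exists>H. h = H oo u_ser"
proof
  show "h = (h oo fps_inv u_ser) oo u_ser"
    using fps_inv[OF u_ser_nth_0 u_ser_nth_1]
    by (simp add: fps_compose_assoc[symmetric] u_ser_nth_0 fps_inv_def)
qed

lemma compose_u_ser_inj: "H oo u_ser = K oo u_ser \<longleftrightarrow> H = K"
  by (rule fps_compose_inj_right[OF u_ser_nth_0 u_ser_nth_1])

text \<open>In the coordinate u, substitution of sigma becomes substitution of -z, which reduces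
  questions about sigma to parity.\<close>

lemma compose_u_ser_compose_sigma: "(H oo u_ser) oo sigma_ser = (H oo (- fps_X)) oo u_ser"
proof -
  have "(H oo u_ser) oo sigma_ser = H oo (- u_ser)"
    by (simp add: fps_compose_assoc[symmetric] u_ser_nth_0 sigma_ser_nth_0 u_ser_compose_sigma)
  also have "- u_ser = (- fps_X) oo u_ser"
    by (simp add: fps_compose_uminus u_ser_nth_0)
  also have "H oo ((- fps_X) oo u_ser) = (H oo (- fps_X)) oo u_ser"
    by (simp add: fps_compose_assoc u_ser_nth_0)
  finally show ?thesis .
qed

lemma compose_u_ser_square: "\<Phi> oo u_ser\<^sup>2 = (\<Phi> oo fps_X\<^sup>2) oo u_ser"
proof -
  have "fps_X\<^sup>2 oo u_ser = u_ser\<^sup>2"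
    by (simp add: fps_compose_power[symmetric] u_ser_nth_0)
  then show ?thesis
    by (simp add: fps_compose_assoc[symmetric] u_ser_nth_0)
qed

lemma compose_sigma_eq_self_iff: "h oo sigma_ser = h \<longleftrightarrow> (\<exists>\<Phi>. h = \<Phi> oo u_ser\<^sup>2)"
proof -
  obtain H where "h = H oo u_ser"
    using ex_compose_u_ser by blast
  then show ?thesis
    by (simp add: compose_u_ser_compose_sigma compose_u_ser_square compose_u_ser_inj fps_even_iff)
qed

lemma compose_sigma_eq_uminus_iff:
  "h oo sigma_ser = - h \<longleftrightarrow> (\<exists>\<Phi>. h = u_ser * (\<Phi> oo u_ser\<^sup>2))"
proof -
  obtain H where H: "h = H oo u_ser"
    using ex_compose_u_ser by blast
  have "u_ser * (\<Phi> oo u_ser\<^sup>2) = (fps_X * (\<Phi> oo fps_X\<^sup>2)) oo u_ser" for \<Phi>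
    by (simp add: compose_u_ser_square fps_compose_mult_distrib u_ser_nth_0)
  then show ?thesis
    by (simp add: H compose_u_ser_compose_sigma compose_u_ser_inj fps_odd_iff
        flip: fps_compose_uminus)
qed

lemma compose_sigma_eigenvalue:
  assumes "h oo sigma_ser = fps_const c * h" and "h \<noteq> 0"
  shows "c = 1 \<or> c = - 1"
proof -
  obtain H where H: "h = H oo u_ser"
    using ex_compose_u_ser by blast
  have "H oo (- fps_X) = fps_const c * H"
    using assms(1) by (simp add: H compose_u_ser_compose_sigma compose_u_ser_inj
        fps_const_mult_apply_left)
  moreover have "H \<noteq> 0"
    using assms(2) H by auto
  ultimately show ?thesis
    by (rule fps_compose_uminus_X_eigenvalue)
qed

lemma compose_u_ser_square_inj: "\<Phi> oo u_ser\<^sup>2 = \<Psi> oo u_ser\<^sup>2 \<longleftrightarrow> \<Phi> = \<Psi>"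
proof -
  have "u_ser\<^sup>2 $ 0 = 0"
    by (simp add: u_ser_nth_0 power2_eq_square)
  then have "(\<Phi> - \<Psi>) oo u_ser\<^sup>2 = 0 \<longleftrightarrow> \<Phi> - \<Psi> = 0"
    using u_ser_nonzero by (subst fps_compose_eq_0_iff) auto
  then show ?thesis
    by (simp add: fps_compose_sub_distrib)
qed

section \<open>Complex powers of 1 - z\<close>

lemma one_minus_pow_0: "one_minus_pow 0 = 1"
  by (simp add: one_minus_pow_def)

lemma one_minus_pow_add: "one_minus_pow (a + b) = one_minus_pow a * one_minus_pow b"
  by (simp add: one_minus_pow_def fps_binomial_add_mult fps_compose_mult_distrib)

lemma one_minus_pow_cancel: "one_minus_pow a * (one_minus_pow (- a) * h) = h"
  by (simp add: mult.assoc[symmetric] one_minus_pow_0 flip: one_minus_pow_add)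

lemma one_minus_pow_nonzero: "one_minus_pow a \<noteq> 0"
  using one_minus_pow_cancel[of a 1] by auto

text \<open>\<open>(1 + (1 / (1 + z) - 1)) ^ a = (1 + z) ^ (- a)\<close>: both sides solve the same
  linear differential equation.\<close>
lemma fps_binomial_compose_inverse:
  fixes a :: "'a :: field_char_0"
  shows "fps_binomial a oo (inverse (1 + fps_X) - 1) = fps_binomial (- a)"
proof -
  define Y :: "'a fps" where "Y = inverse (1 + fps_X) - 1"
  define F where "F = fps_binomial a oo Y"
  have Y0: "Y $ 0 = 0"
    by (simp add: Y_def)
  have inv: "(1 + fps_X) * inverse (1 + fps_X) = (1 :: 'a fps)"
    by (rule inverse_mult_eq_1') simp
  have "fps_deriv Y = - (inverse (1 + fps_X))\<^sup>2"
    by (simp add: Y_def fps_inverse_deriv)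
  \<comment> \<open>Since 1 + Y = 1/(1 + z), taking the reciprocal returns 1 + z.\<close>
  moreover have "inverse (1 + fps_X) oo Y = 1 + fps_X"
  proof -
    have "inverse (1 + fps_X) oo Y = inverse ((1 + fps_X) oo Y)"
      by (rule fps_inverse_compose) (simp_all add: Y0)
    also have "(1 + fps_X) oo Y = inverse (1 + fps_X)"
      by (simp add: fps_compose_add_distrib Y0) (simp add: Y_def)
    finally show ?thesis
      by simp
  qed
  moreover have "fps_deriv F = (fps_const a * F * (inverse (1 + fps_X) oo Y)) * fps_deriv Y"
    by (simp add: F_def fps_compose_deriv Y0 fps_binomial_deriv fps_divide_unit
        fps_compose_mult_distrib)
  \<comment> \<open>The factor 1 + z cancels one of the two reciprocals in Y', leaving the equation
    F' = -a F/(1 + z).\<close>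
  ultimately have "fps_deriv F
      = - (fps_const a * F * ((1 + fps_X) * inverse (1 + fps_X)) * inverse (1 + fps_X))"
    by (simp add: power2_eq_square algebra_simps)
  then have "fps_deriv F = fps_const (- a) * F / (1 + fps_X)"
    by (simp add: inv fps_divide_unit flip: fps_const_neg)
  moreover have "F $ 0 = 1"
    by (simp add: F_def)
  ultimately show ?thesis
    using fps_binomial_ODE_unique' unfolding F_def Y_def by blast
qed

text \<open>This is \<open>fps_binomial_compose_inverse\<close> with -z in place of z, because
  -sigma = z/(1 - z) = 1/(1 - z) - 1.\<close>

lemma one_minus_pow_compose_sigma: "one_minus_pow a oo sigma_ser = one_minus_pow (- a)"
proof -
  have "- sigma_ser = (inverse (1 + fps_X) - 1) oo (- fps_X)"
  proof -
    have "(1 - fps_X) * inverse (1 - fps_X) = (1 :: complex fps)"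
      by (rule inverse_mult_eq_1') simp
    then have "fps_X * inverse (1 - fps_X) = inverse (1 - fps_X) - (1 :: complex fps)"
      by (simp add: algebra_simps)
    then show ?thesis
      by (simp add: sigma_ser_def fps_divide_unit fps_compose_sub_distrib
          fps_inverse_compose fps_compose_add_distrib)
  qed
  moreover have "one_minus_pow a oo sigma_ser = fps_binomial a oo (- sigma_ser)"
    by (simp add: one_minus_pow_def fps_compose_assoc[symmetric] sigma_ser_nth_0
        fps_compose_uminus)
  ultimately show ?thesis
    by (simp add: one_minus_pow_def fps_compose_assoc flip: fps_binomial_compose_inverse)
qed

section \<open>The eigenspaces\<close>

text \<open>Under sigma the factor of exponent q/2 acquires exponent -q/2, and the weight restores
  it: q - q/2 = q/2.\<close>

lemma T_op_conjugate:
  "T_op q (one_minus_pow (q / 2) * g) = one_minus_pow (q / 2) * (g oo sigma_ser)"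
proof -
  have "T_op q (one_minus_pow (q / 2) * g)
      = (one_minus_pow q * one_minus_pow (- (q / 2))) * (g oo sigma_ser)"
    by (simp add: T_op_def fps_compose_mult_distrib sigma_ser_nth_0 one_minus_pow_compose_sigma
        mult.assoc)
  then show ?thesis
    by (simp flip: one_minus_pow_add)
qed

lemma T_op_eigenvector_iff:
  "T_op q (one_minus_pow (q / 2) * g) = fps_const c * (one_minus_pow (q / 2) * g)
    \<longleftrightarrow> g oo sigma_ser = fps_const c * g"
  by (simp add: T_op_conjugate one_minus_pow_nonzero mult.left_commute[of "fps_const c"])

lemma eigenspace_T_op:
  "eigenspace (T_op q) c = {one_minus_pow (q / 2) * g | g. g oo sigma_ser = fps_const c * g}"
proof (intro set_eqI iffI)
  fix h
  assume "h \<in> eigenspace (T_op q) c"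
  \<comment> \<open>Every series has this form, since (1 - z)^(q/2) is a unit with inverse of
    exponent -q/2.\<close>
  moreover obtain g where "h = one_minus_pow (q / 2) * g"
    using one_minus_pow_cancel by metis
  ultimately show "h \<in> {one_minus_pow (q / 2) * g | g. g oo sigma_ser = fps_const c * g}"
    by (auto simp: eigenspace_def T_op_eigenvector_iff)
qed (auto simp: eigenspace_def T_op_eigenvector_iff)

lemma eigenvalue_T_op:
  "eigenvalue (T_op q) c \<longleftrightarrow> (\<exists>g. g \<noteq> 0 \<and> g oo sigma_ser = fps_const c * g)"
proof -
  have "eigenvalue (T_op q) c \<longleftrightarrow> (\<exists>h \<in> eigenspace (T_op q) c. h \<noteq> 0)"
    by (auto simp: eigenvalue_def eigenspace_def)
  then show ?thesis
    by (auto simp: eigenspace_T_op one_minus_pow_nonzero)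
qed

theorem proposition2p8:
  fixes U :: "complex fps" and q :: complex
  shows "((U oo sigma_ser) = - U \<longleftrightarrow> (\<exists>!\<Phi> :: complex fps. U = u_ser * (\<Phi> oo u_ser\<^sup>2))) \<and>
    {c. eigenvalue (T_op q) c} = {1, - 1} \<and>
    eigenspace (T_op q) 1 = {one_minus_pow (q / 2) * f | f. f \<in> fps_in_u_sq} \<and>
    eigenspace (T_op q) (- 1) = {one_minus_pow (q / 2) * (u_ser * f) | f. f \<in> fps_in_u_sq}"
proof (intro conjI)
  \<comment> \<open>Only uniqueness needs an argument; \<open>compose_sigma_eq_uminus_iff\<close>
    supplies existence.\<close>
  have "\<Phi> = \<Psi>" if "u_ser * (\<Phi> oo u_ser\<^sup>2) = u_ser * (\<Psi> oo u_ser\<^sup>2)" for \<Phi> \<Psi>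
    using that u_ser_nonzero compose_u_ser_square_inj by simp
  then show "(U oo sigma_ser) = - U \<longleftrightarrow> (\<exists>!\<Phi> :: complex fps. U = u_ser * (\<Phi> oo u_ser\<^sup>2))"
    unfolding compose_sigma_eq_uminus_iff by blast
next
  \<comment> \<open>After conjugation, the constant series 1 and u itself are eigenvectors for 1 and
    -1, so both values occur for every q.\<close>
  have "eigenvalue (T_op q) 1"
    unfolding eigenvalue_T_op by (rule exI[of _ 1]) simp
  moreover have "eigenvalue (T_op q) (- 1)"
    unfolding eigenvalue_T_op using u_ser_compose_sigma u_ser_nonzero
    by (intro exI[of _ u_ser]) (simp flip: fps_const_neg)
  ultimately show "{c. eigenvalue (T_op q) c} = {1, - 1}"
    using compose_sigma_eigenvalue by (auto simp: eigenvalue_T_op)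
next
  show "eigenspace (T_op q) 1 = {one_minus_pow (q / 2) * f | f. f \<in> fps_in_u_sq}"
    by (auto simp: eigenspace_T_op fps_in_u_sq_def compose_sigma_eq_self_iff)
next
  have "g oo sigma_ser = fps_const (- 1) * g \<longleftrightarrow> (\<exists>\<Phi>. g = u_ser * (\<Phi> oo u_ser\<^sup>2))" for g
    by (simp add: compose_sigma_eq_uminus_iff flip: fps_const_neg)
  then show "eigenspace (T_op q) (- 1)
      = {one_minus_pow (q / 2) * (u_ser * f) | f. f \<in> fps_in_u_sq}"
    by (auto simp: eigenspace_T_op fps_in_u_sq_def)
qed

end
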